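(* Consider the planar ($d=2$) Boolean model whose grains are i.i.d. discs centred at the points of the Poisson process (the germs), with random radius distributed as an almost surely bounded random variable $R$. Then the total visibility $\mathfrak V$ satisfies $$\lim_{r\to+\infty}\frac1r\,\log \mathbb P\left(\mathfrak V\ge r\right)=-2\,\mathbb E[R].$$
   Context: Let $\mathbf X$ be a homogeneous Poisson point process in $\mathbb R^2$ with intensity measure the Lebesgue measure. Let $(R_x)_{x\in\mathbf X}$ be i.i.d. copies of a positive, almost surely bounded random variable $R$, independent of $\mathbf X$. The occupied phase is $\mathfrak O=\bigcup_{x\in\mathbf X}B_2(x,R_x)$, where $B_2(x,\rho)$ is the disc of centre $x$ and radius $\rho$. The model is conditioned on the event $\{O\notin\mathfrak O\}$ (of positive probability), where $O$ is the origin; $\mathbb P$ denotes the probability under this conditioning. For a unit vector $\mathbf u$, $V(\mathbf u)=\inf\{s>0: s\mathbf u\in\mathfrak O\}$ (with $\inf\emptyset=+\infty$), and the total visibility is $\mathfrak V=\sup_{\|\mathbf u\|=1}V(\mathbf u)$. *)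

theory Defs
  imports "HOL-Probability.Probability"
begin

text \<open>
  A point process in the plane is given by an enumeration \<open>X 0, X 1, \<dots>\<close> of its points by random
  vectors. A homogeneous Poisson process has almost surely infinitely many points and they are
  almost surely distinct, so no padding is needed.
\<close>

definition num_points :: "(nat \<Rightarrow> 'w \<Rightarrow> real^2) \<Rightarrow> (real^2) set \<Rightarrow> 'w \<Rightarrow> enat" where
  "num_points X A \<omega> =
     (if finite {n. X n \<omega> \<in> A} then enat (card {n. X n \<omega> \<in> A}) else \<infinity>)"

text \<open>
  In \<open>poisson_count\<close>, the probabilities sum to one over \<open>k\<close>, so the number of points in
  a set of finite area is almost surely finite; for area \<open>0\<close> the convention \<open>0 ^ 0 = 1\<close> gives
  the Dirac law at \<open>0\<close>.
\<close>

locale poisson_process = prob_space M for M :: "'w measure" +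
  fixes X :: "nat \<Rightarrow> 'w \<Rightarrow> real^2"
  assumes points_measurable: "\<And>n. X n \<in> borel_measurable M"
    and points_distinct: "AE \<omega> in M. inj (\<lambda>n. X n \<omega>)"
    and poisson_count: "\<And>A k. A \<in> sets borel \<Longrightarrow> emeasure lborel A < \<infinity> \<Longrightarrow>
          \<P>(\<omega> in M. num_points X A \<omega> = enat k)
            = measure lborel A ^ k / fact k * exp (- measure lborel A)"
    and independent_counts: "\<And>(A :: nat \<Rightarrow> (real^2) set) m. disjoint_family_on A {..<m} \<Longrightarrow>
          (\<And>i. i < m \<Longrightarrow> A i \<in> sets borel \<and> emeasure lborel (A i) < \<infinity>) \<Longrightarrow>
          indep_vars (\<lambda>_. count_space UNIV) (\<lambda>i. num_points X (A i)) {..<m}"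

text \<open>
  \<open>\<rho> n\<close> is the radius attached to the germ \<open>X n\<close>. The typical radius \<open>R\<close> may live on a different
  probability space \<open>N\<close>; only its law is shared with the \<open>\<rho> n\<close>.
\<close>

locale disc_boolean_model = poisson_process M X
  for M :: "'w measure" and X :: "nat \<Rightarrow> 'w \<Rightarrow> real^2" +
  fixes \<rho> :: "nat \<Rightarrow> 'w \<Rightarrow> real" and N :: "'v measure" and R :: "'v \<Rightarrow> real"
  assumes typical_prob_space: "prob_space N"
    and typical_measurable: "R \<in> borel_measurable N"
    and radii_independent: "indep_vars (\<lambda>_. borel) \<rho> UNIV"
    and radii_law: "\<And>n. distr M borel (\<rho> n) = distr N borel R"
    and radii_indep_points:
      "indep_set (sets (vimage_algebra (space M) (\<lambda>\<omega> n. X n \<omega>) (Pi\<^sub>M UNIV (\<lambda>_. borel))))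
                 (sets (vimage_algebra (space M) (\<lambda>\<omega> n. \<rho> n \<omega>) (Pi\<^sub>M UNIV (\<lambda>_. borel))))"

text \<open>Discs are closed, as is usual for grains of a Boolean model.\<close>

definition occupied :: "(nat \<Rightarrow> 'w \<Rightarrow> real^2) \<Rightarrow> (nat \<Rightarrow> 'w \<Rightarrow> real) \<Rightarrow> 'w \<Rightarrow> (real^2) set" where
  "occupied X \<rho> \<omega> = (\<Union>n. cball (X n \<omega>) (\<rho> n \<omega>))"

definition visibility :: "(real^2) set \<Rightarrow> real^2 \<Rightarrow> ereal" where
  "visibility S u = Inf {ereal s | s. 0 < s \<and> s *\<^sub>R u \<in> S}"

definition total_visibility :: "(real^2) set \<Rightarrow> ereal" where
  "total_visibility S = (SUP u\<in>{u. norm u = 1}. visibility S u)"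

text \<open>
  Conditional probability that the total visibility is at least \<open>r\<close>, given that the origin is not
  covered. The event \<open>total_visibility \<ge> r\<close> involves an uncountable supremum; it is measurable
  only up to a null set (on which the configuration fails to be locally finite), whence the
  completion.
\<close>

definition visibility_tail ::
  "'w measure \<Rightarrow> (nat \<Rightarrow> 'w \<Rightarrow> real^2) \<Rightarrow> (nat \<Rightarrow> 'w \<Rightarrow> real) \<Rightarrow> real \<Rightarrow> real" where
  "visibility_tail M X \<rho> r =
     \<P>(\<omega> in completion M. ereal r \<le> total_visibility (occupied X \<rho> \<omega>) \<bar> 0 \<notin> occupied X \<rho> \<omega>)"

end

theory Submission imports Defs "HOL-Real_Asymp.Real_Asymp" begin

text \<open>
  The event that the total visibility is at least \<open>r\<close> lies between two void events of a thinned Poisson process.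
  It contains the event that one fixed segment of length \<open>r\<close> from the origin is free, and it forces a
  free segment of length \<open>r - 1\<close> in some direction. That direction is within \<open>h / (r - 1)\<close> of one of
  \<open>O(r / h)\<close> grid directions, and there the discs shrunk by \<open>h\<close> must miss the grid segment; the
  union bound costs only a factor linear in \<open>r\<close>.
  For a segment of length \<open>s\<close>, cut its neighbourhood into strips of points at distance between
  \<open>j h\<close> and \<open>(j + 1) h\<close> from the line. Each strip has area \<open>2 s h\<close>, so independence of the counts
  gives a void probability \<open>exp (- 2 s (\<Sum>j. h P(R \<ge> j h)))\<close> up to shifts of \<open>j\<close>, and the Riemann
  sum is within \<open>O(h)\<close> of \<open>E[R]\<close>. Finally \<open>h\<close> tends to \<open>0\<close>.
\<close>

subsection \<open>Directions and strips in the plane\<close>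

definition dir :: "real \<Rightarrow> real^2" where
  "dir \<theta> = vector [cos \<theta>, sin \<theta>]"

lemma dir_nth [simp]: "dir \<theta> $ 1 = cos \<theta>" "dir \<theta> $ 2 = sin \<theta>"
  by (simp_all add: dir_def)

lemma inner_vec2: "x \<bullet> y = x $ 1 * y $ 1 + x $ 2 * y $ 2" for x y :: "real^2"
  by (simp add: inner_vec_def sum_2)

lemma norm_dir [simp]: "norm (dir \<theta>) = 1"
  by (simp add: norm_eq_1 inner_vec2 flip: power2_eq_square)

text \<open>The chord between two points of the unit circle has length
  \<open>2 * \<bar>sin ((\<theta> - \<phi>) / 2)\<bar>\<close>, which is at most the length of the
  arc.\<close>

lemma norm_dir_diff_le: "norm (dir \<theta> - dir \<phi>) \<le> \<bar>\<theta> - \<phi>\<bar>"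
proof (rule power2_le_imp_le)
  have "(norm (dir \<theta> - dir \<phi>))\<^sup>2 = 2 - 2 * cos (\<theta> - \<phi>)"
    using sin_cos_squared_add[of \<theta>] sin_cos_squared_add[of \<phi>]
    unfolding power2_norm_eq_inner
    by (simp add: inner_vec2 cos_diff algebra_simps power2_eq_square)
  also have "\<dots> = (2 * sin ((\<theta> - \<phi>) / 2))\<^sup>2"
  proof -
    have "2 * ((\<theta> - \<phi>) / 2) = \<theta> - \<phi>" by simp
    then show ?thesis
      using cos_double_sin[of "(\<theta> - \<phi>) / 2"] by (simp only: power_mult_distrib) simp
  qed
  also have "\<dots> \<le> \<bar>\<theta> - \<phi>\<bar>\<^sup>2"
    using abs_sin_x_le_abs_x[of "(\<theta> - \<phi>) / 2"] by (subst abs_le_square_iff[symmetric]) simp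
  finally show "(norm (dir \<theta> - dir \<phi>))\<^sup>2 \<le> \<bar>\<theta> - \<phi>\<bar>\<^sup>2" .
qed simp

lemma unit_vector_dirE:
  fixes u :: "real^2"
  assumes "norm u = 1"
  obtains \<theta> where "0 \<le> \<theta>" "\<theta> < 2 * pi" "u = dir \<theta>"
proof -
  have "(u $ 1)\<^sup>2 + (u $ 2)\<^sup>2 = 1"
    using assms by (simp add: norm_eq_1 inner_vec2 power2_eq_square)
  from sincos_total_2pi[OF this] obtain \<theta> where "0 \<le> \<theta>" "\<theta> < 2 * pi" "u $ 1 = cos \<theta>" "u $ 2 = sin \<theta>"
    by blast
  then show ?thesis
    by (intro that[of \<theta>]) (auto simp: vec_eq_iff forall_2)
qed

lemma inner_dir_plus_pi_half: "x \<bullet> dir (\<theta> + pi / 2) = x $ 2 * cos \<theta> - x $ 1 * sin \<theta>"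
  by (simp add: inner_vec2 cos_add sin_add)

lemma dir_decomp: "x = (x \<bullet> dir \<theta>) *\<^sub>R dir \<theta> + (x \<bullet> dir (\<theta> + pi / 2)) *\<^sub>R dir (\<theta> + pi / 2)"
proof -
  \<comment> \<open>The vectors \<open>dir \<theta>\<close> and
    \<open>dir (\<theta> + pi / 2)\<close> are orthonormal. In coordinates the claim is a polynomial
    identity modulo this relation.\<close>
  have "cos \<theta> * cos \<theta> = 1 - sin \<theta> * sin \<theta>"
    using sin_cos_squared_add[of \<theta>] by (simp add: power2_eq_square)
  then show ?thesis
    unfolding inner_dir_plus_pi_half
    by (simp add: vec_eq_iff forall_2 inner_vec2 cos_add sin_add) algebra
qed

lemma dist_foot: "norm (x - (x \<bullet> dir \<theta>) *\<^sub>R dir \<theta>) = \<bar>x \<bullet> dir (\<theta> + pi / 2)\<bar>"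
proof -
  have "x - (x \<bullet> dir \<theta>) *\<^sub>R dir \<theta> = (x \<bullet> dir (\<theta> + pi / 2)) *\<^sub>R dir (\<theta> + pi / 2)"
    using dir_decomp[of x \<theta>] by (simp add: algebra_simps)
  then show ?thesis by simp
qed

section \<open>Rotated rectangles and the strips that tile them\<close>

definition slab :: "real \<Rightarrow> real \<Rightarrow> real \<Rightarrow> real \<Rightarrow> (real^2) set" where
  "slab \<theta> a b h = {x. a < x \<bullet> dir \<theta> \<and> x \<bullet> dir \<theta> < b \<and> \<bar>x \<bullet> dir (\<theta> + pi / 2)\<bar> < h}"

lemma open_slab: "open (slab \<theta> a b h)"
  unfolding slab_def by (intro open_Collect_conj open_Collect_less continuous_intros)

text \<open>An orthogonal map carries the axis-parallel box with sides \<open>b - a\<close> and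
  \<open>2 * h\<close> onto the slab, and such maps preserve area.\<close>

lemma slab_measure:
  assumes "a \<le> b" "0 \<le> h"
  shows "slab \<theta> a b h \<in> lmeasurable" "measure lborel (slab \<theta> a b h) = 2 * (b - a) * h"
proof -
  define T :: "real^2 \<Rightarrow> real^2" where "T y = y $ 1 *\<^sub>R dir \<theta> + y $ 2 *\<^sub>R dir (\<theta> + pi / 2)" for y
  define Q where "Q = box (vector [a, - h]) (vector [b, h] :: real^2)"
  have T: "orthogonal_transformation T"
    unfolding orthogonal_transformation_def
  proof safe
    show "linear T"
      by (rule linearI) (simp_all add: T_def algebra_simps)
    have "cos \<theta> * cos \<theta> = 1 - sin \<theta> * sin \<theta>"
      using sin_cos_squared_add[of \<theta>] by (simp add: power2_eq_square)
    then show "T v \<bullet> T w = v \<bullet> w" for v w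
      by (simp add: T_def inner_vec2 cos_add sin_add) algebra
  qed
  have coord: "T y \<bullet> dir \<theta> = y $ 1" "T y \<bullet> dir (\<theta> + pi / 2) = y $ 2" for y
  proof -
    have "cos \<theta> * cos \<theta> = 1 - sin \<theta> * sin \<theta>"
      using sin_cos_squared_add[of \<theta>] by (simp add: power2_eq_square)
    then show "T y \<bullet> dir \<theta> = y $ 1" "T y \<bullet> dir (\<theta> + pi / 2) = y $ 2"
      by (simp_all add: T_def inner_vec2 cos_add sin_add) algebra+
  qed
  have slab: "slab \<theta> a b h = T ` Q"
  proof safe
    fix x assume x: "x \<in> slab \<theta> a b h"
    have "x = T (vector [x \<bullet> dir \<theta>, x \<bullet> dir (\<theta> + pi / 2)])"
      using dir_decomp[of x \<theta>] by (simp add: T_def)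
    moreover have "vector [x \<bullet> dir \<theta>, x \<bullet> dir (\<theta> + pi / 2)] \<in> Q"
      using x by (auto simp: Q_def slab_def mem_box_cart forall_2)
    ultimately show "x \<in> T ` Q" by blast
  qed (auto simp: Q_def slab_def mem_box_cart forall_2 coord)
  have Q: "Q \<in> lmeasurable" by (simp add: Q_def)
  show "slab \<theta> a b h \<in> lmeasurable"
    unfolding slab by (rule measurable_orthogonal_image[OF T Q])
  have B: "(Basis :: (real^2) set) = {axis 1 1, axis 2 1}"
    by (auto simp: Basis_vec_def UNIV_2)
  have "measure lborel Q = 2 * (b - a) * h"
    unfolding Q_def using assms by (simp add: measure_lborel_box_eq B inner_axis axis_eq_axis algebra_simps)
  moreover have "measure lborel (slab \<theta> a b h) = measure lborel Q"
    using measure_orthogonal_image[OF T Q] open_slab[of \<theta> a b h] by (simp add: slab Q_def)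
  ultimately show "measure lborel (slab \<theta> a b h) = 2 * (b - a) * h" by simp
qed

text \<open>Each strip has one band on either side of the line. The distances to the line run
  through half-open intervals, which makes strips with different \<open>j\<close> disjoint, and the
  area does not depend on \<open>j\<close>.\<close>

definition strip :: "real \<Rightarrow> real \<Rightarrow> real \<Rightarrow> real \<Rightarrow> nat \<Rightarrow> (real^2) set" where
  "strip \<theta> a b h j = slab \<theta> a b (real (Suc j) * h) - slab \<theta> a b (real j * h)"

lemma mem_strip:
  assumes "0 \<le> h"
  shows "x \<in> strip \<theta> a b h j \<longleftrightarrow> a < x \<bullet> dir \<theta> \<and> x \<bullet> dir \<theta> < b
    \<and> real j * h \<le> \<bar>x \<bullet> dir (\<theta> + pi / 2)\<bar> \<and> \<bar>x \<bullet> dir (\<theta> + pi / 2)\<bar> < real (Suc j) * h"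
  by (auto simp: strip_def slab_def)

lemma strip_borel: "strip \<theta> a b h j \<in> sets borel"
  unfolding strip_def by (intro sets.Diff borel_open open_slab)

lemma strip_measure:
  assumes "a \<le> b" "0 \<le> h"
  shows "emeasure lborel (strip \<theta> a b h j) < \<infinity>" "measure lborel (strip \<theta> a b h j) = 2 * (b - a) * h"
proof -
  let ?S = "\<lambda>j. slab \<theta> a b (real j * h)"
  have fin: "emeasure lborel (?S j) < \<infinity>" for j
    using slab_measure(1)[of a b "real j * h" \<theta>] assms open_slab[of \<theta> a b "real j * h"]
    by (auto simp: fmeasurable_def)
  then have "emeasure lborel (?S (Suc j)) < \<infinity>" .
  then show "emeasure lborel (strip \<theta> a b h j) < \<infinity>"
    unfolding strip_def by (rule le_less_trans[rotated]) (auto intro!: emeasure_mono borel_open open_slab)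
  have "?S j \<subseteq> ?S (Suc j)"
    using assms by (auto simp: slab_def algebra_simps)
  then have "measure lborel (strip \<theta> a b h j) = measure lborel (?S (Suc j)) - measure lborel (?S j)"
    unfolding strip_def using fin[of "Suc j"]
    by (intro measure_Diff) (auto intro: borel_open open_slab)
  also have "\<dots> = 2 * (b - a) * h"
    using assms by (simp add: slab_measure algebra_simps)
  finally show "measure lborel (strip \<theta> a b h j) = 2 * (b - a) * h" .
qed

lemma disjoint_strips:
  assumes "0 \<le> h"
  shows "disjoint_family_on (strip \<theta> a b h) J"
proof -
  have "strip \<theta> a b h i \<inter> strip \<theta> a b h j = {}" if "i < j" for i j
  proof -
    have "real (Suc i) * h \<le> real j * h"
      using that assms by (intro mult_right_mono) auto
    then show ?thesis by (auto simp: mem_strip[OF assms])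
  qed
  then show ?thesis
    unfolding disjoint_family_on_def by (metis Int_commute nat_neq_iff)
qed

lemma strip_cover:
  assumes h: "0 < h" and x: "a < x \<bullet> dir \<theta>" "x \<bullet> dir \<theta> < b" "\<bar>x \<bullet> dir (\<theta> + pi / 2)\<bar> < real m * h"
  obtains j where "j < m" "x \<in> strip \<theta> a b h j"
proof -
  define y where "y = \<bar>x \<bullet> dir (\<theta> + pi / 2)\<bar> / h"
  define j where "j = nat \<lfloor>y\<rfloor>"
  have y: "0 \<le> y" "y < real m" "\<bar>x \<bullet> dir (\<theta> + pi / 2)\<bar> = y * h"
    using h x by (auto simp: y_def field_simps)
  then have j: "real j \<le> y" "y < real (Suc j)"
    unfolding j_def by linarith+
  then have "j < m" using y by linarith
  moreover have "x \<in> strip \<theta> a b h j"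
    using h j x(1,2) by (auto simp: mem_strip y(3))
  ultimately show ?thesis by (rule that)
qed

subsection \<open>Visibility in terms of free segments\<close>

lemma visibility_geI:
  assumes "\<And>t. 0 < t \<Longrightarrow> t < r \<Longrightarrow> t *\<^sub>R u \<notin> S"
  shows "ereal r \<le> visibility S u"
  unfolding visibility_def using assms by (intro Inf_greatest) (force simp: not_less)

lemma free_of_visibility_gt:
  assumes "ereal s < visibility S u" "0 < t" "t \<le> s"
  shows "t *\<^sub>R u \<notin> S"
proof
  assume "t *\<^sub>R u \<in> S"
  then have "visibility S u \<le> ereal t"
    unfolding visibility_def using assms by (intro Inf_lower) auto
  then show False using assms by (meson ereal_less_eq(3) leD order_trans)
qed

text \<open>The supremum over directions need not be attained, so a free direction is guaranteed
  only up to a length \<open>s\<close> strictly below \<open>r\<close>.\<close>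

lemma total_visibility_free_direction:
  assumes "ereal r \<le> total_visibility S" "s < r"
  obtains \<theta> where "0 \<le> \<theta>" "\<theta> < 2 * pi" "\<And>t. 0 < t \<Longrightarrow> t \<le> s \<Longrightarrow> t *\<^sub>R dir \<theta> \<notin> S"
proof -
  have "ereal s < total_visibility S"
    using assms by (meson ereal_less_eq(3) less_ereal.simps(1) less_le_trans)
  then obtain u where u: "norm u = 1" "ereal s < visibility S u"
    unfolding total_visibility_def less_SUP_iff by auto
  obtain \<theta> where "0 \<le> \<theta>" "\<theta> < 2 * pi" "u = dir \<theta>"
    using unit_vector_dirE[OF u(1)] .
  then show ?thesis
    using free_of_visibility_gt[OF u(2)] that by blast
qed

lemma total_visibility_geI:
  assumes "\<And>t. 0 < t \<Longrightarrow> t < r \<Longrightarrow> t *\<^sub>R dir \<theta> \<notin> S"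
  shows "ereal r \<le> total_visibility S"
  unfolding total_visibility_def
  by (rule SUP_upper2[of "dir \<theta>"]) (use visibility_geI[of r "dir \<theta>" S] assms in auto)

text \<open>Lengths approaching \<open>r\<close> from below make up for a supremum that is not
  attained. As the origin is free, \<open>t = 0\<close> can be included, which makes the segments
  compact; this prepares the proof of measurability.\<close>

lemma total_visibility_ge_iff:
  assumes "0 \<notin> S"
  shows "ereal r \<le> total_visibility S \<longleftrightarrow>
    (\<forall>k::nat. \<exists>\<theta>. \<forall>t\<in>{0..r - 1 / real (Suc k)}. t *\<^sub>R dir \<theta> \<notin> S)" (is "_ \<longleftrightarrow> ?R")
proof safe
  fix k :: nat
  assume "ereal r \<le> total_visibility S"
  then obtain \<theta> where \<theta>: "\<And>t. 0 < t \<Longrightarrow> t \<le> r - 1 / real (Suc k) \<Longrightarrow> t *\<^sub>R dir \<theta> \<notin> S"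
    using total_visibility_free_direction[of r S "r - 1 / real (Suc k)"] by auto
  have "t *\<^sub>R dir \<theta> \<notin> S" if "t \<in> {0..r - 1 / real (Suc k)}" for t
    using \<theta>[of t] that assms by (cases "t = 0") auto
  then show "\<exists>\<theta>. \<forall>t\<in>{0..r - 1 / real (Suc k)}. t *\<^sub>R dir \<theta> \<notin> S" by blast
next
  assume *: ?R
  show "ereal r \<le> total_visibility S"
  proof (rule ereal_le_epsilon2)
    fix e :: real assume "0 < e"
    then obtain k where k: "1 / real (Suc k) < e"
      using nat_approx_posE by blast
    obtain \<theta> where "\<forall>t\<in>{0..r - 1 / real (Suc k)}. t *\<^sub>R dir \<theta> \<notin> S" using * by blast
    then have "ereal (r - 1 / real (Suc k)) \<le> total_visibility S"
      by (intro total_visibility_geI[of _ \<theta>]) auto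
    then have "ereal (r - 1 / real (Suc k)) + ereal e \<le> total_visibility S + ereal e"
      by (rule add_right_mono)
    moreover have "ereal r \<le> ereal (r - 1 / real (Suc k)) + ereal e"
      using k by simp
    ultimately show "ereal r \<le> total_visibility S + ereal e" by (rule order_trans[rotated])
  qed
qed

text \<open>The segment is compact and the part of \<open>S\<close> within reach is closed, so they
  have a positive distance \<open>\<delta>\<close>, and a small turn cannot close the gap. This
  reduces the choice of a direction to a countable one.\<close>

lemma rational_free_direction:
  assumes C: "closed (S \<inter> cball 0 s)" and free: "\<forall>t\<in>{0..s}. t *\<^sub>R dir \<theta> \<notin> S"
  obtains q :: rat where "\<forall>t\<in>{0..s}. t *\<^sub>R dir (of_rat q) \<notin> S"
proof -
  have "compact ((\<lambda>t. t *\<^sub>R dir \<theta>) ` {0..s})"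
    by (intro compact_continuous_image continuous_intros) auto
  from separate_compact_closed[OF this C] free obtain \<delta>
    where \<delta>: "0 < \<delta>" "\<And>t y. t \<in> {0..s} \<Longrightarrow> y \<in> S \<inter> cball 0 s \<Longrightarrow> \<delta> \<le> dist (t *\<^sub>R dir \<theta>) y"
    by (fastforce simp: disjoint_iff)
  \<comment> \<open>A turn by less than \<open>\<delta> / (\<bar>s\<bar> + 1)\<close> moves every
    point of the segment by less than \<open>\<delta>\<close>; the \<open>+ 1\<close> keeps the
    denominator positive when \<open>s = 0\<close>.\<close>
  obtain q :: rat where q: "\<theta> < of_rat q" "of_rat q < \<theta> + \<delta> / (\<bar>s\<bar> + 1)"
    using of_rat_dense[of \<theta> "\<theta> + \<delta> / (\<bar>s\<bar> + 1)"] \<delta>(1) by auto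
  have "t *\<^sub>R dir (of_rat q) \<notin> S" if t: "t \<in> {0..s}" for t
  proof
    assume "t *\<^sub>R dir (of_rat q) \<in> S"
    then have "\<delta> \<le> dist (t *\<^sub>R dir \<theta>) (t *\<^sub>R dir (of_rat q))"
      using t by (intro \<delta>(2)) auto
    also have "\<dots> = t * norm (dir \<theta> - dir (of_rat q))"
      using t by (simp add: dist_norm flip: scaleR_diff_right)
    also have "\<dots> \<le> s * \<bar>\<theta> - of_rat q\<bar>"
      using t by (intro mult_mono norm_dir_diff_le) auto
    also have "\<dots> < (\<bar>s\<bar> + 1) * (\<delta> / (\<bar>s\<bar> + 1))"
      using q t by (intro mult_strict_mono) auto
    also have "\<dots> = \<delta>" by simp
    finally show False by simp
  qed
  then show ?thesis using that by blast
qed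

subsection \<open>Void probabilities of the marked process\<close>

text \<open>The sum counts the multiples of \<open>h\<close> up to \<open>x\<close>, starting with
  \<open>0\<close>, so it exceeds \<open>x\<close> by at most one step.\<close>

lemma sum_threshold_upper:
  fixes x h :: real
  assumes "0 \<le> x" "0 \<le> h"
  shows "(\<Sum>j<m. h * of_bool (real j * h \<le> x)) \<le> x + h"
proof -
  \<comment> \<open>The bound by \<open>real m * h\<close> is added for the induction: when the next
    threshold is still at most \<open>x\<close>, it is the bound that carries over.\<close>
  have "(\<Sum>j<m. h * of_bool (real j * h \<le> x)) \<le> min (x + h) (real m * h)"
    by (induction m) (use assms in \<open>auto simp: algebra_simps min_def split: if_splits\<close>)
  then show ?thesis by simp
qed

text \<open>Shifting the thresholds by two steps loses at most \<open>2 * h\<close>. The cap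
  \<open>real m * h\<close> reflects that only \<open>m\<close> thresholds are available; it is
  inactive once they reach beyond \<open>x\<close>.\<close>

lemma sum_threshold_lower:
  fixes x h :: real
  assumes "0 \<le> h"
  shows "min (x - 2 * h) (real m * h) \<le> (\<Sum>j<m. h * of_bool (real (j + 2) * h \<le> x))"
  by (induction m) (use assms in \<open>auto simp: algebra_simps min_def split: if_splits\<close>)

text \<open>For \<open>a = b\<close> these are the Poisson weights with total mass one; for
  \<open>a = q * b\<close> the series is the generating function of the Poisson law at
  \<open>q\<close>.\<close>

lemma poisson_sums: "(\<lambda>k. (a::real) ^ k / fact k * exp (- b)) sums (exp (a - b))"
  using sums_mult2[OF exp_converges[of a], of "exp (- b)"]
  by (simp add: exp_diff exp_minus field_simps)

context disc_boolean_model
begin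

section \<open>The joint law of germs and radii\<close>

lemma radius_measurable: "\<rho> n \<in> borel_measurable M"
  using radii_independent by (auto simp: indep_vars_def)

lemma points_sequence_measurable: "(\<lambda>\<omega> n. X n \<omega>) \<in> measurable M (Pi\<^sub>M UNIV (\<lambda>_. borel))"
  by (rule measurable_PiM_single') (auto simp: points_measurable)

lemma radii_sequence_measurable: "(\<lambda>\<omega> n. \<rho> n \<omega>) \<in> measurable M (Pi\<^sub>M UNIV (\<lambda>_. borel))"
  by (rule measurable_PiM_single') (auto simp: radius_measurable)

text \<open>Independence of the two whole sequences gives the product formula on measurable
  rectangles, which determines the joint law. The radii can then be integrated out with the germs
  held fixed.\<close>

lemma points_radii_distr:
  "distr M (Pi\<^sub>M UNIV (\<lambda>_. borel)) (\<lambda>\<omega> n. X n \<omega>) \<Otimes>\<^sub>M distr M (Pi\<^sub>M UNIV (\<lambda>_. borel)) (\<lambda>\<omega> n. \<rho> n \<omega>)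
    = distr M (Pi\<^sub>M UNIV (\<lambda>_. borel) \<Otimes>\<^sub>M Pi\<^sub>M UNIV (\<lambda>_. borel)) (\<lambda>\<omega>. (\<lambda>n. X n \<omega>, \<lambda>n. \<rho> n \<omega>))"
    (is "distr M ?S ?X \<Otimes>\<^sub>M distr M ?T ?\<rho> = distr M (?S \<Otimes>\<^sub>M ?T) ?Z")
proof (rule pair_measure_eqI)
  note [measurable] = points_sequence_measurable radii_sequence_measurable
  interpret P: prob_space "distr M ?S ?X" by (rule prob_space_distr) measurable
  interpret Q: prob_space "distr M ?T ?\<rho>" by (rule prob_space_distr) measurable
  show "sigma_finite_measure (distr M ?S ?X)" "sigma_finite_measure (distr M ?T ?\<rho>)"
    by unfold_locales
  show "sets (distr M ?S ?X \<Otimes>\<^sub>M distr M ?T ?\<rho>) = sets (distr M (?S \<Otimes>\<^sub>M ?T) ?Z)"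
    by (simp cong: sets_pair_measure_cong)
  fix A B assume "A \<in> sets (distr M ?S ?X)" "B \<in> sets (distr M ?T ?\<rho>)"
  then have A[measurable]: "A \<in> sets ?S" and B[measurable]: "B \<in> sets ?T" by auto
  have "prob ((?X -` A \<inter> space M) \<inter> (?\<rho> -` B \<inter> space M)) = prob (?X -` A \<inter> space M) * prob (?\<rho> -` B \<inter> space M)"
    by (rule indep_setD[OF radii_indep_points]) (auto intro!: in_vimage_algebra)
  moreover have "?Z -` (A \<times> B) \<inter> space M = (?X -` A \<inter> space M) \<inter> (?\<rho> -` B \<inter> space M)"
    by auto
  ultimately show "emeasure (distr M ?S ?X) A * emeasure (distr M ?T ?\<rho>) B = emeasure (distr M (?S \<Otimes>\<^sub>M ?T) ?Z) (A \<times> B)"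
    by (simp add: emeasure_distr emeasure_eq_measure ennreal_mult)
qed

lemma prob_radius:
  assumes "B \<in> sets borel"
  shows "prob (\<rho> n -` B \<inter> space M) = measure (distr N borel R) B"
  using assms radius_measurable[of n] by (simp add: radii_law[of n, symmetric] measure_distr)

text \<open>By Fubini the germs may be frozen. The radii are then independent with the law of
  \<open>R\<close>, so each germ contributes the measure of its section of \<open>D\<close>.\<close>

lemma prob_marks_finite:
  assumes D: "D \<in> sets (borel \<Otimes>\<^sub>M borel)"
  shows "prob {\<omega> \<in> space M. \<forall>n<k. (X n \<omega>, \<rho> n \<omega>) \<in> D}
    = (\<integral>\<omega>. (\<Prod>n<k. measure (distr N borel R) (Pair (X n \<omega>) -` D)) \<partial>M)"
proof -
  let ?S = "Pi\<^sub>M UNIV (\<lambda>_. borel) :: (nat \<Rightarrow> real^2) measure"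
  let ?T = "Pi\<^sub>M UNIV (\<lambda>_. borel) :: (nat \<Rightarrow> real) measure"
  let ?X = "\<lambda>\<omega> n. X n \<omega>" and ?\<rho> = "\<lambda>\<omega> n. \<rho> n \<omega>"
  define f where "f x = measure (distr N borel R) (Pair x -` D)" for x :: "real^2"
  interpret N: prob_space N by (rule typical_prob_space)
  interpret L: prob_space "distr N borel R"
    by (rule N.prob_space_distr[OF typical_measurable])
  have X[measurable]: "?X \<in> measurable M ?S" and \<rho>[measurable]: "?\<rho> \<in> measurable M ?T"
    and dist: "distr M ?S ?X \<Otimes>\<^sub>M distr M ?T ?\<rho> = distr M (?S \<Otimes>\<^sub>M ?T) (\<lambda>x. (?X x, ?\<rho> x))"
    using points_sequence_measurable radii_sequence_measurable points_radii_distr by auto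
  interpret P: prob_space "distr M ?T ?\<rho>" by (rule prob_space_distr[OF \<rho>])
  note [measurable] = D points_measurable radius_measurable
  have sec: "Pair x -` D \<in> sets borel" for x
    using sets_Pair1[OF D] by simp
  have f_meas[measurable]: "f \<in> borel_measurable borel"
    unfolding f_def measure_def
    by (intro borel_measurable_enn2real L.measurable_emeasure_Pair) (use D in \<open>simp cong: sets_pair_measure_cong\<close>)
  have f01: "0 \<le> f x" "f x \<le> 1" for x
    by (auto simp: f_def)
  define E where "E = {z \<in> space (?S \<Otimes>\<^sub>M ?T). \<forall>n<k. (fst z n, snd z n) \<in> D}"
  have E[measurable]: "E \<in> sets (?S \<Otimes>\<^sub>M ?T)"
    unfolding E_def by measurable
  have inner: "emeasure (distr M ?T ?\<rho>) (Pair x -` E) = ennreal (\<Prod>n<k. f (x n))" for x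
  proof -
    have "emeasure (distr M ?T ?\<rho>) (Pair x -` E) = emeasure M (?\<rho> -` (Pair x -` E) \<inter> space M)"
      by (rule emeasure_distr[OF \<rho>]) (rule sets_Pair1[OF E])
    also have "?\<rho> -` (Pair x -` E) \<inter> space M
        = {\<omega> \<in> space M. \<forall>n<k. \<rho> n \<omega> \<in> Pair (x n) -` D}"
      by (auto simp: E_def space_pair_measure space_PiM)
    also have "prob \<dots> = (\<Prod>n<k. f (x n))"
    proof (cases "k = 0")
      case True
      then show ?thesis by (simp add: prob_space)
    next
      case False
      then have "{\<omega> \<in> space M. \<forall>n<k. \<rho> n \<omega> \<in> Pair (x n) -` D}
          = (\<Inter>n\<in>{..<k}. \<rho> n -` (Pair (x n) -` D) \<inter> space M)"
        by auto
      also have "prob \<dots> = (\<Prod>n<k. prob (\<rho> n -` (Pair (x n) -` D) \<inter> space M))"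
        using False by (intro indep_varsD[OF radii_independent]) (auto simp: sec)
      finally show ?thesis
        by (simp add: prob_radius[OF sec] f_def)
    qed
    then have "emeasure M {\<omega> \<in> space M. \<forall>n<k. \<rho> n \<omega> \<in> Pair (x n) -` D} = ennreal (\<Prod>n<k. f (x n))"
      by (simp add: emeasure_eq_measure)
    finally show ?thesis .
  qed
  have "{\<omega> \<in> space M. \<forall>n<k. (X n \<omega>, \<rho> n \<omega>) \<in> D} = (\<lambda>x. (?X x, ?\<rho> x)) -` E \<inter> space M"
    by (auto simp: E_def space_pair_measure space_PiM)
  then have "emeasure M {\<omega> \<in> space M. \<forall>n<k. (X n \<omega>, \<rho> n \<omega>) \<in> D}
      = emeasure (distr M ?S ?X \<Otimes>\<^sub>M distr M ?T ?\<rho>) E"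
    by (simp add: dist emeasure_distr)
  also have "\<dots> = (\<integral>\<^sup>+x. ennreal (\<Prod>n<k. f (x n)) \<partial>distr M ?S ?X)"
    by (subst P.emeasure_pair_measure_alt) (auto simp: inner cong: sets_pair_measure_cong)
  also have "\<dots> = (\<integral>\<^sup>+\<omega>. ennreal (\<Prod>n<k. f (X n \<omega>)) \<partial>M)"
    by (subst nn_integral_distr) auto
  also have "\<dots> = ennreal (\<integral>\<omega>. (\<Prod>n<k. f (X n \<omega>)) \<partial>M)"
  proof (rule nn_integral_eq_integral)
    show "integrable M (\<lambda>\<omega>. \<Prod>n<k. f (X n \<omega>))"
      by (rule integrable_const_bound[where B=1])
        (auto simp: abs_prod f01 intro!: prod_le_1)
  qed (auto intro!: prod_nonneg simp: f01)
  finally show ?thesis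
    unfolding f_def[symmetric]
    by (simp add: emeasure_eq_measure integral_nonneg prod_nonneg f01)
qed

section \<open>Poisson counts and their generating function\<close>

lemma num_points_measurable:
  assumes "A \<in> sets borel" "emeasure lborel A < \<infinity>"
  shows "num_points X A \<in> measurable M (count_space UNIV)"
  \<comment> \<open>A family with one member is trivially disjoint, and independence of its counts
    includes their measurability.\<close>
  using independent_counts[where m="Suc 0" and A="\<lambda>_. A"] assms
  by (auto simp: indep_vars_def disjoint_family_on_def)

lemma prob_num_points:
  assumes "A \<in> sets borel" "emeasure lborel A < \<infinity>"
  shows "prob (num_points X A -` {enat k} \<inter> space M)
    = measure lborel A ^ k / fact k * exp (- measure lborel A)"
  using poisson_count[OF assms, of k] by (simp add: vimage_def Int_def conj_commute)

text \<open>The Poisson weights of the finite values already sum to one, which leaves no mass for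
  the value \<open>\<infinity>\<close>.\<close>

lemma AE_num_points_finite:
  assumes A: "A \<in> sets borel" "emeasure lborel A < \<infinity>"
  shows "AE \<omega> in M. finite {n. X n \<omega> \<in> A}"
proof -
  note m[measurable] = num_points_measurable[OF A]
  let ?E = "\<lambda>k. num_points X A -` {enat k} \<inter> space M"
  have E: "range ?E \<subseteq> events"
    using m by (auto intro: measurable_sets)
  have "(\<lambda>k. prob (?E k)) sums prob (\<Union>k. ?E k)"
    by (rule finite_measure_UNION[OF E]) (auto simp: disjoint_family_on_def)
  moreover have "(\<lambda>k. prob (?E k)) sums 1"
    using poisson_sums[of "measure lborel A" "measure lborel A"] by (simp add: prob_num_points[OF A])
  ultimately have "prob (\<Union>k. ?E k) = 1"
    by (rule sums_unique2)
  then have "AE \<omega> in M. \<omega> \<in> (\<Union>k. ?E k)"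
    by (rule AE_prob_1)
  then show ?thesis
    by eventually_elim (auto simp: num_points_def split: if_splits)
qed

lemma expectation_num_points_power:
  fixes q :: real
  assumes A: "A \<in> sets borel" "emeasure lborel A < \<infinity>" and q: "0 \<le> q" "q \<le> 1"
  shows "(\<integral>\<omega>. q ^ the_enat (num_points X A \<omega>) \<partial>M) = exp (- (measure lborel A * (1 - q)))"
proof -
  note m[measurable] = num_points_measurable[OF A]
  define a where "a = measure lborel A"
  let ?E = "\<lambda>k. num_points X A -` {enat k} \<inter> space M"
  let ?f = "\<lambda>k \<omega>. q ^ k * indicator (?E k) \<omega>"
  have E[measurable]: "?E k \<in> events" for k
    using m by (auto intro: measurable_sets)
  have int: "(\<integral>\<omega>. ?f k \<omega> \<partial>M) = (q * a) ^ k / fact k * exp (- a)" for k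
    using E[of k] by (simp add: prob_num_points[OF A] a_def power_mult_distrib)
  \<comment> \<open>When the count is finite, exactly one term of the series can be nonzero, the one
    whose \<open>k\<close> is the count. The value of \<open>the_enat\<close> at
    \<open>\<infinity>\<close> matters only on a null set.\<close>
  have eq: "AE \<omega> in M. (\<lambda>k. ?f k \<omega>) sums q ^ the_enat (num_points X A \<omega>)"
    using AE_num_points_finite[OF A] AE_space
  proof eventually_elim
    case (elim \<omega>)
    then have n: "num_points X A \<omega> = enat (card {n. X n \<omega> \<in> A})"
      by (simp add: num_points_def)
    have "(\<lambda>k. ?f k \<omega>) = (\<lambda>k. if k = card {n. X n \<omega> \<in> A} then q ^ k else 0)"
      using elim by (auto simp: n indicator_def)
    then show ?case
      using sums_single[of "card {n. X n \<omega> \<in> A}" "\<lambda>k. q ^ k"] by (simp add: n)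
  qed
  have "(\<integral>\<omega>. q ^ the_enat (num_points X A \<omega>) \<partial>M) = (\<integral>\<omega>. (\<Sum>k. ?f k \<omega>) \<partial>M)"
    by (rule integral_cong_AE) (use eq E in \<open>auto simp: sums_iff\<close>)
  also have "(\<lambda>k. \<integral>\<omega>. ?f k \<omega> \<partial>M) sums \<dots>"
  proof (rule sums_integral)
    show "integrable M (?f k)" for k
      using E[of k] by (auto simp: less_top[symmetric])
    show "AE \<omega> in M. summable (\<lambda>k. norm (?f k \<omega>))"
      using eq by eventually_elim (use q in \<open>auto simp: sums_iff abs_mult\<close>)
    show "summable (\<lambda>k. \<integral>\<omega>. norm (?f k \<omega>) \<partial>M)"
      using int poisson_sums[of "q * a" a] q by (simp add: sums_iff abs_mult)
  qed
  then have "(\<lambda>k. (q * a) ^ k / fact k * exp (- a)) sums (\<integral>\<omega>. (\<Sum>k. ?f k \<omega>) \<partial>M)"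
    unfolding int .
  then have "(\<integral>\<omega>. (\<Sum>k. ?f k \<omega>) \<partial>M) = exp (q * a - a)"
    using poisson_sums[of "q * a" a] by (rule sums_unique2)
  finally show ?thesis
    by (simp add: a_def algebra_simps)
qed

text \<open>This is the void probability of the Poisson process of germs with marks. Given the
  germs, each one in \<open>A j\<close> is admissible with probability \<open>P(R < t j)\<close>, so
  the conditional probability is a product of powers of these numbers. Independence of the counts
  and the Poisson generating function give its expectation.\<close>

lemma void_prob:
  fixes A :: "nat \<Rightarrow> (real^2) set" and t :: "nat \<Rightarrow> real"
  assumes disj: "disjoint_family_on A {..<m}"
    and A: "\<And>j. j < m \<Longrightarrow> A j \<in> sets borel" "\<And>j. j < m \<Longrightarrow> emeasure lborel (A j) < \<infinity>"
  shows "prob {\<omega> \<in> space M. \<forall>n. \<forall>j<m. X n \<omega> \<in> A j \<longrightarrow> \<rho> n \<omega> < t j}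
    = exp (- (\<Sum>j<m. measure lborel (A j) * measure N {v \<in> space N. t j \<le> R v}))"
proof -
  define D :: "((real^2) \<times> real) set" where "D = {z. \<forall>j<m. fst z \<in> A j \<longrightarrow> snd z < t j}"
  define L where "L = distr N borel R"
  define q where "q j = measure L {..<t j}" for j
  define f where "f x = (\<Prod>j<m. if x \<in> A j then q j else 1)" for x
  interpret N: prob_space N by (rule typical_prob_space)
  interpret L: prob_space L
    unfolding L_def by (rule N.prob_space_distr[OF typical_measurable])
  note A' = A A(2)[simplified]
  note [measurable] = A(1) points_measurable radius_measurable typical_measurable
  have D: "D \<in> sets (borel \<Otimes>\<^sub>M borel)"
  proof -
    have "{z \<in> space (borel \<Otimes>\<^sub>M borel). \<forall>j<m. fst z \<in> A j \<longrightarrow> snd z < t j}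
        \<in> sets (borel \<Otimes>\<^sub>M borel)"
      by measurable
    then show ?thesis by (simp add: D_def space_pair_measure)
  qed
  have q01: "0 \<le> q j" "q j \<le> 1" for j
    by (auto simp: q_def)
  have q_eq: "1 - q j = measure N {v \<in> space N. t j \<le> R v}" for j
  proof -
    have "1 - q j = measure L {t j..}"
      using L.prob_compl[of "{..<t j}"] unfolding q_def
      by (simp add: L_def Compl_eq_Diff_UNIV[symmetric] not_less flip: atLeast_def)
    also have "\<dots> = measure N {v \<in> space N. t j \<le> R v}"
      unfolding L_def by (subst measure_distr) (auto intro!: arg_cong[where f="measure N"])
    finally show ?thesis .
  qed
  \<comment> \<open>By disjointness at most one \<open>A i\<close> contains \<open>x\<close>. The
    section is then the half-line below \<open>t i\<close>, or the whole line if there is no such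
    set, and at most one factor of \<open>f x\<close> differs from one.\<close>
  have f_sec: "measure L (Pair x -` D) = f x" for x
  proof (cases "\<exists>i<m. x \<in> A i")
    case True
    then obtain i where i: "i < m" "x \<in> A i" by auto
    then have u: "x \<in> A j \<longleftrightarrow> j = i" if "j < m" for j
      using disj that by (auto simp: disjoint_family_on_def)
    have "Pair x -` D = {..<t i}"
      using i u by (auto simp: D_def)
    moreover have "f x = (\<Prod>j<m. if j = i then q i else 1)"
      unfolding f_def by (intro prod.cong) (auto simp: u)
    ultimately show ?thesis
      using i by (simp add: q_def prod.delta)
  next
    case False
    then have "Pair x -` D = UNIV" "f x = 1"
      by (auto simp: D_def f_def intro!: prod.neutral)
    then show ?thesis
      using L.prob_space by (simp add: L_def)
  qed
  \<comment> \<open>Only the first \<open>k\<close> germs are inspected, so that the finite marking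
    formula applies; the events decrease to the one in question as \<open>k\<close> grows.\<close>
  let ?W = "\<lambda>k. {\<omega> \<in> space M. \<forall>n<k. (X n \<omega>, \<rho> n \<omega>) \<in> D}"
  have prob_W: "prob (?W k) = (\<integral>\<omega>. (\<Prod>n<k. f (X n \<omega>)) \<partial>M)" for k
    using prob_marks_finite[OF D, of k] f_sec by (simp add: L_def)
  have f01: "0 \<le> f x" "f x \<le> 1" for x
    by (auto simp: f_def q01 intro!: prod_nonneg prod_le_1)
  have f_meas[measurable]: "f \<in> borel_measurable borel"
    unfolding f_def by measurable
  have W: "?W k \<in> events" for k
    using D by measurable
  have "(\<lambda>k. prob (?W k)) \<longlonglongrightarrow> prob (\<Inter>k. ?W k)"
  proof (rule finite_Lim_measure_decseq)
    show "range ?W \<subseteq> events" using W by blast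
    show "decseq ?W" unfolding decseq_def by fastforce
  qed
  moreover have "(\<lambda>k. prob (?W k)) \<longlonglongrightarrow> (\<integral>\<omega>. (\<Prod>j<m. q j ^ the_enat (num_points X (A j) \<omega>)) \<partial>M)"
    unfolding prob_W
  proof (rule integral_dominated_convergence[where w="\<lambda>_. 1"])
    show "(\<lambda>\<omega>. \<Prod>j<m. q j ^ the_enat (num_points X (A j) \<omega>)) \<in> borel_measurable M"
      by (intro borel_measurable_prod measurable_compose[OF num_points_measurable]) (auto simp: A')
    have "AE \<omega> in M. \<forall>j\<in>{..<m}. finite {n. X n \<omega> \<in> A j}"
      by (rule AE_finite_allI) (auto intro!: AE_num_points_finite A')
    then show "AE \<omega> in M. (\<lambda>k. \<Prod>n<k. f (X n \<omega>)) \<longlonglongrightarrow> (\<Prod>j<m. q j ^ the_enat (num_points X (A j) \<omega>))"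
    proof eventually_elim
      case (elim \<omega>)
      have *: "(\<Prod>n<k. f (X n \<omega>)) = (\<Prod>j<m. q j ^ card {n. n < k \<and> X n \<omega> \<in> A j})" for k
        unfolding f_def
        by (subst prod.swap) (simp add: prod.If_cases Int_def)
      show ?case
        unfolding *
      proof (rule tendsto_prod)
        fix j assume "j \<in> {..<m}"
        then have fin: "finite {n. X n \<omega> \<in> A j}" using elim by auto
        then obtain k0 where k0: "\<forall>n\<in>{n. X n \<omega> \<in> A j}. n < k0"
          using finite_nat_set_iff_bounded by blast
        \<comment> \<open>Almost surely only finitely many indices fall in \<open>A j\<close>, so
          the count among the first \<open>k\<close> germs becomes stationary.\<close>
        have "\<forall>\<^sub>F k in sequentially. q j ^ card {n. n < k \<and> X n \<omega> \<in> A j}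
            = q j ^ the_enat (num_points X (A j) \<omega>)"
          using eventually_ge_at_top[of k0]
        proof eventually_elim
          case (elim k)
          then have "{n. n < k \<and> X n \<omega> \<in> A j} = {n. X n \<omega> \<in> A j}"
            using k0 by auto
          then show ?case using fin by (simp add: num_points_def)
        qed
        then show "(\<lambda>k. q j ^ card {n. n < k \<and> X n \<omega> \<in> A j})
            \<longlonglongrightarrow> q j ^ the_enat (num_points X (A j) \<omega>)"
          by (rule tendsto_eventually)
      qed
    qed
    show "AE \<omega> in M. norm (\<Prod>n<k. f (X n \<omega>)) \<le> 1" for k
      by (auto simp: abs_prod f01 intro!: prod_le_1)
  qed auto
  ultimately have "prob (\<Inter>k. ?W k) = (\<integral>\<omega>. (\<Prod>j<m. q j ^ the_enat (num_points X (A j) \<omega>)) \<partial>M)"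
    by (rule LIMSEQ_unique)
  also have "(\<Inter>k. ?W k) = {\<omega> \<in> space M. \<forall>n. \<forall>j<m. X n \<omega> \<in> A j \<longrightarrow> \<rho> n \<omega> < t j}"
    by (auto simp: D_def)
  also have "(\<integral>\<omega>. (\<Prod>j<m. q j ^ the_enat (num_points X (A j) \<omega>)) \<partial>M)
      = (\<Prod>j<m. \<integral>\<omega>. q j ^ the_enat (num_points X (A j) \<omega>) \<partial>M)"
  proof (rule indep_vars_lebesgue_integral)
    show "indep_vars (\<lambda>_. borel) (\<lambda>j \<omega>. q j ^ the_enat (num_points X (A j) \<omega>)) {..<m}"
      by (rule indep_vars_compose2[OF independent_counts]) (auto simp: disj A')
    show "integrable M (\<lambda>\<omega>. q j ^ the_enat (num_points X (A j) \<omega>))" if "j \<in> {..<m}" for j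
      by (rule integrable_const_bound[where B=1])
        (use that in \<open>auto simp: q01 abs_mult power_abs intro!: power_le_one
            measurable_compose[OF num_points_measurable] A'\<close>)
  qed auto
  also have "\<dots> = (\<Prod>j<m. exp (- (measure lborel (A j) * (1 - q j))))"
    by (intro prod.cong) (auto intro!: expectation_num_points_power A' q01)
  also have "\<dots> = exp (- (\<Sum>j<m. measure lborel (A j) * measure N {v \<in> space N. t j \<le> R v}))"
    by (simp add: exp_sum q_eq flip: sum_negf)
  finally show ?thesis .
qed

lemma sum_threshold_integral:
  "(\<integral>v. (\<Sum>j<m. h * of_bool (t j \<le> R v)) \<partial>N) = (\<Sum>j<m. h * measure N {v \<in> space N. t j \<le> R v})"
  "integrable N (\<lambda>v. (\<Sum>j<m. h * of_bool (t j \<le> R v)))" for t :: "nat \<Rightarrow> real" and h :: real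
proof -
  interpret N: prob_space N by (rule typical_prob_space)
  note [measurable] = typical_measurable
  have ind: "h * of_bool (t j \<le> R v) = h * indicator {v \<in> space N. t j \<le> R v} v" if "v \<in> space N" for j v
    using that by simp
  have int: "integrable N (\<lambda>v. h * of_bool (t j \<le> R v))" for j
    by (subst Bochner_Integration.integrable_cong[OF refl ind]) (auto simp: less_top[symmetric])
  have "(\<integral>v. h * of_bool (t j \<le> R v) \<partial>N) = h * measure N {v \<in> space N. t j \<le> R v}" for j
    by (subst Bochner_Integration.integral_cong[OF refl ind]) auto
  then show "(\<integral>v. (\<Sum>j<m. h * of_bool (t j \<le> R v)) \<partial>N) = (\<Sum>j<m. h * measure N {v \<in> space N. t j \<le> R v})"
    using int by (simp only: Bochner_Integration.integral_sum)
  show "integrable N (\<lambda>v. (\<Sum>j<m. h * of_bool (t j \<le> R v)))"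
    using int by (intro Bochner_Integration.integrable_sum) auto
qed

end

subsection \<open>The visibility tail for bounded radii\<close>

locale bounded_disc_model = disc_boolean_model M X \<rho> N R
  for M :: "'w measure" and X :: "nat \<Rightarrow> 'w \<Rightarrow> real^2" and \<rho> :: "nat \<Rightarrow> 'w \<Rightarrow> real"
    and N :: "'v measure" and R :: "'v \<Rightarrow> real" +
  fixes K :: real
  assumes R_pos: "AE v in N. 0 < R v"
    and R_le: "AE v in N. R v \<le> K"
    and K_pos: "0 < K"
begin

section \<open>Riemann sums for the mean radius\<close>

lemma R_integrable: "integrable N R"
proof -
  interpret N: prob_space N by (rule typical_prob_space)
  have "AE v in N. norm (R v) \<le> K"
    using R_pos R_le by eventually_elim auto
  then show ?thesis
    by (rule N.integrable_const_bound) (rule typical_measurable)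
qed

text \<open>The sum is the expectation of a step function of \<open>R\<close> that exceeds
  \<open>R\<close> by at most \<open>h\<close>. Positivity of \<open>R\<close> enters here, through
  the pointwise bound.\<close>

lemma threshold_sum_upper:
  assumes "0 < h"
  shows "(\<Sum>j<m. h * measure N {v \<in> space N. real j * h \<le> R v}) \<le> integral\<^sup>L N R + h"
proof -
  interpret N: prob_space N by (rule typical_prob_space)
  have "(\<integral>v. (\<Sum>j<m. h * of_bool (real j * h \<le> R v)) \<partial>N) \<le> (\<integral>v. R v + h \<partial>N)"
  proof (rule integral_mono_AE)
    show "AE v in N. (\<Sum>j<m. h * of_bool (real j * h \<le> R v)) \<le> R v + h"
      using R_pos by eventually_elim (use assms in \<open>intro sum_threshold_upper; simp\<close>)
  qed (use R_integrable sum_threshold_integral(2) in auto)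
  also have "\<dots> = integral\<^sup>L N R + h"
    using R_integrable by (simp add: N.prob_space)
  finally show ?thesis by (simp only: sum_threshold_integral)
qed

text \<open>As \<open>R\<close> is at most \<open>K\<close>, the assumption
  \<open>K \<le> real m * h\<close> disables the cap in the pointwise bound.\<close>

lemma threshold_sum_lower:
  assumes "0 < h" "K \<le> real m * h"
  shows "integral\<^sup>L N R - 2 * h \<le> (\<Sum>j<m. h * measure N {v \<in> space N. real (j + 2) * h \<le> R v})"
proof -
  interpret N: prob_space N by (rule typical_prob_space)
  have "integral\<^sup>L N R - 2 * h = (\<integral>v. R v - 2 * h \<partial>N)"
    using R_integrable by (simp add: N.prob_space)
  also have "\<dots> \<le> (\<integral>v. (\<Sum>j<m. h * of_bool (real (j + 2) * h \<le> R v)) \<partial>N)"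
  proof (rule integral_mono_AE)
    show "AE v in N. R v - 2 * h \<le> (\<Sum>j<m. h * of_bool (real (j + 2) * h \<le> R v))"
      using R_le
    proof eventually_elim
      case (elim v)
      then show ?case
        using sum_threshold_lower[of h "R v" m] assms by (simp add: min_def split: if_splits)
    qed
  qed (use R_integrable sum_threshold_integral(2) in auto)
  finally show ?thesis by (simp only: sum_threshold_integral)
qed

lemma AE_radii_le: "AE \<omega> in M. \<forall>n. \<rho> n \<omega> \<le> K"
proof -
  have "AE \<omega> in M. \<rho> n \<omega> \<le> K" for n
  proof -
    have "AE y in distr N borel R. y \<le> K"
      using R_le typical_measurable by (subst AE_distr_iff) auto
    then have "AE y in distr M borel (\<rho> n). y \<le> K"
      by (subst radii_law)
    then show ?thesis
      using radius_measurable[of n] by (subst (asm) AE_distr_iff) auto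
  qed
  then show ?thesis by (simp add: AE_all_countable)
qed

text \<open>A disc of radius at most \<open>K\<close> that meets \<open>cball 0 s\<close> has its
  germ within distance \<open>s + K\<close> of the origin. Almost surely there are finitely many
  such germs, and a finite union of closed discs is closed.\<close>

lemma AE_occupied_locally_closed: "AE \<omega> in M. \<forall>s. closed (occupied X \<rho> \<omega> \<inter> cball 0 s)"
proof -
  have "AE \<omega> in M. \<forall>i::nat. finite {n. X n \<omega> \<in> cball 0 (real i)}"
    unfolding AE_all_countable
    by (intro allI AE_num_points_finite) (auto simp: emeasure_lborel_cball_finite[simplified])
  with AE_radii_le show ?thesis
  proof eventually_elim
    case (elim \<omega>)
    show ?case
    proof
      fix s :: real
      obtain i :: nat where i: "s + K \<le> real i" using real_arch_simple by blast
      define F where "F = {n. X n \<omega> \<in> cball 0 (real i)}"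
      have "n \<in> F" if "y \<in> cball (X n \<omega>) (\<rho> n \<omega>)" "y \<in> cball 0 s" for n y
      proof -
        have "norm (X n \<omega>) \<le> dist (X n \<omega>) y + norm y"
          by (metis add.commute dist_norm norm_triangle_sub)
        also have "\<dots> \<le> \<rho> n \<omega> + s" using that by auto
        also have "\<dots> \<le> real i" using i elim(1)[rule_format, of n] by simp
        finally show ?thesis by (simp add: F_def)
      qed
      then have "occupied X \<rho> \<omega> \<inter> cball 0 s = (\<Union>n\<in>F. cball (X n \<omega>) (\<rho> n \<omega>)) \<inter> cball 0 s"
        unfolding occupied_def by blast
      moreover have "finite F" using elim(2) by (simp add: F_def)
      ultimately show "closed (occupied X \<rho> \<omega> \<inter> cball 0 s)"
        by (simp add: closed_Int closed_UN)
    qed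
  qed
qed

section \<open>Free segments in a fixed direction\<close>

definition free_segment :: "real \<Rightarrow> real \<Rightarrow> 'w set" where
  "free_segment s \<theta> = {\<omega> \<in> space M. \<forall>t\<in>{0..s}. t *\<^sub>R dir \<theta> \<notin> occupied X \<rho> \<omega>}"

text \<open>A disc misses the compact segment exactly when its radius is below the distance from its
  centre to the segment. This turns the uncountable condition over \<open>t\<close> into a countable
  one over the germs.\<close>

lemma free_segment_events [measurable]: "free_segment s \<theta> \<in> events"
proof (cases "0 \<le> s")
  case True
  define T where "T = (\<lambda>t. t *\<^sub>R dir \<theta>) ` {0..s}"
  have T: "compact T" "T \<noteq> {}"
    using True unfolding T_def by (auto intro!: compact_continuous_image continuous_intros)
  have "(\<forall>y\<in>T. y \<notin> cball x p) \<longleftrightarrow> p < infdist x T" for x :: "real^2" and p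
  proof safe
    assume *: "\<forall>y\<in>T. y \<notin> cball x p"
    obtain y where "y \<in> T" "infdist x T = dist x y"
      using infdist_attains_inf[of T x] T compact_imp_closed by blast
    then show "p < infdist x T" using * by (auto simp: not_le)
  next
    fix y assume "p < infdist x T" "y \<in> T" "y \<in> cball x p"
    then show False using infdist_le[of y T x] by simp
  qed
  then have "free_segment s \<theta> = {\<omega> \<in> space M. \<forall>n. \<rho> n \<omega> < infdist (X n \<omega>) T}"
    unfolding free_segment_def occupied_def T_def by blast
  also have "\<dots> \<in> events"
  proof -
    have [measurable]: "(\<lambda>x. infdist x T) \<in> borel_measurable borel"
      by (intro borel_measurable_continuous_onI continuous_intros)
    note [measurable] = points_measurable radius_measurable
    show ?thesis by measurable
  qed
  finally show ?thesis .
qed (simp add: free_segment_def)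

text \<open>The segment is free if every germ near it has a radius below its distance to the line.
  Extending the window by \<open>K + 1\<close> at both ends captures every germ whose disc could
  meet the segment, and changes the length only by a constant.\<close>

lemma prob_free_segment_ge:
  assumes "0 \<le> r" "0 < h"
  shows "exp (- 2 * (r + 2 * K + 2) * (integral\<^sup>L N R + h)) \<le> prob (free_segment r 0)"
proof -
  let ?a = "- K - 1" and ?b = "r + K + 1"
  obtain m :: nat where "K / h < real m" using reals_Archimedean2 by blast
  then have m: "K < real m * h" using assms by (simp add: field_simps)
  let ?A = "strip 0 ?a ?b h"
  \<comment> \<open>The threshold is the inner distance of the strip, a lower bound for the distance
    of its points to the line. For \<open>j = 0\<close> it is zero, so almost surely the central
    strip has to be empty of germs.\<close>
  define W where "W = {\<omega> \<in> space M. \<forall>n. \<forall>j<m. X n \<omega> \<in> ?A j \<longrightarrow> \<rho> n \<omega> < real j * h}"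
  have ab: "?a \<le> ?b" "0 \<le> h" using assms K_pos by auto
  have prob_W: "prob W = exp (- (\<Sum>j<m. measure lborel (?A j) * measure N {v \<in> space N. real j * h \<le> R v}))"
    unfolding W_def by (rule void_prob[OF disjoint_strips[OF ab(2)] strip_borel strip_measure(1)[OF ab]])
  have "(\<Sum>j<m. measure lborel (?A j) * measure N {v \<in> space N. real j * h \<le> R v})
      = 2 * (r + 2 * K + 2) * (\<Sum>j<m. h * measure N {v \<in> space N. real j * h \<le> R v})"
    by (simp add: strip_measure[OF ab] sum_distrib_left mult.assoc) (simp add: algebra_simps)
  also have "\<dots> \<le> 2 * (r + 2 * K + 2) * (integral\<^sup>L N R + h)"
    using assms K_pos by (intro mult_left_mono threshold_sum_upper) auto
  finally have "exp (- 2 * (r + 2 * K + 2) * (integral\<^sup>L N R + h)) \<le> prob W"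
    by (simp only: prob_W exp_le_cancel_iff mult_minus_left neg_le_iff_le)
  also have "prob W \<le> prob (free_segment r 0)"
  proof (rule finite_measure_mono_AE)
    show "AE \<omega> in M. \<omega> \<in> W \<longrightarrow> \<omega> \<in> free_segment r 0"
      using AE_radii_le
    proof eventually_elim
      case (elim \<omega>)
      show ?case
      proof
        assume W: "\<omega> \<in> W"
        have "t *\<^sub>R dir 0 \<notin> cball (X n \<omega>) (\<rho> n \<omega>)" if t: "t \<in> {0..r}" for n t
        proof
          assume hit: "t *\<^sub>R dir 0 \<in> cball (X n \<omega>) (\<rho> n \<omega>)"
          let ?d = "X n \<omega> - t *\<^sub>R dir 0"
          have d: "norm ?d \<le> \<rho> n \<omega>" using hit by (simp add: dist_norm)
          \<comment> \<open>By Cauchy-Schwarz, the centre of a disc that meets the segment at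
            \<open>t\<close> differs from that point by at most the radius, both along and across
            the line.\<close>
          have 1: "\<bar>X n \<omega> \<bullet> dir 0 - t\<bar> \<le> \<rho> n \<omega>"
            using Cauchy_Schwarz_ineq2[of ?d "dir 0"] d
            by (simp add: inner_diff_left norm_eq_1[THEN iffD1, OF norm_dir])
          have 2: "\<bar>X n \<omega> \<bullet> dir (0 + pi / 2)\<bar> \<le> \<rho> n \<omega>"
            using Cauchy_Schwarz_ineq2[of ?d "dir (0 + pi / 2)"] d
            by (simp add: inner_diff_left inner_dir_plus_pi_half[of _ 0, simplified])
          have "\<rho> n \<omega> \<le> K" using elim by blast
          then have "?a < X n \<omega> \<bullet> dir 0" "X n \<omega> \<bullet> dir 0 < ?b" "\<bar>X n \<omega> \<bullet> dir (0 + pi / 2)\<bar> < real m * h"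
            using 1 2 m t unfolding abs_le_iff atLeastAtMost_iff by linarith+
          from strip_cover[OF assms(2) this] obtain j where j: "j < m" "X n \<omega> \<in> ?A j" .
          then have "\<rho> n \<omega> < real j * h" "real j * h \<le> \<bar>X n \<omega> \<bullet> dir (0 + pi / 2)\<bar>"
            using W assms by (auto simp: W_def mem_strip)
          then show False using 2 by simp
        qed
        then show "\<omega> \<in> free_segment r 0"
          using W by (auto simp: free_segment_def W_def occupied_def)
      qed
    qed
  qed measurable
  finally show ?thesis .
qed

section \<open>Union bound over a grid of directions\<close>

text \<open>A measurable superset \<open>U\<close> is produced, so no measurability of the existence
  of a free direction has to be discussed. For an upper bound it is enough to use germs whose
  projection lies strictly inside the segment, so the window is not extended.\<close>

lemma free_direction_cover:
  assumes "0 \<le> s" "0 < h"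
  obtains U where "U \<in> events"
    "prob U \<le> (2 * pi * s / h + 2) * exp (- 2 * s * (integral\<^sup>L N R - 2 * h))"
    "\<And>\<omega> \<theta>. \<omega> \<in> space M \<Longrightarrow> 0 \<le> \<theta> \<Longrightarrow> \<theta> < 2 * pi \<Longrightarrow>
      (\<And>t. 0 < t \<Longrightarrow> t \<le> s \<Longrightarrow> t *\<^sub>R dir \<theta> \<notin> occupied X \<rho> \<omega>) \<Longrightarrow> \<omega> \<in> U"
proof -
  obtain m :: nat where "K / h < real m" using reals_Archimedean2 by blast
  then have m: "K \<le> real m * h" using assms by (simp add: field_simps)
  \<comment> \<open>The number of directions is chosen so that the grid spacing
    \<open>2 * pi / k\<close> times \<open>s\<close> is at most \<open>h\<close>. The
    \<open>Suc\<close> keeps it positive even if \<open>s = 0\<close>, and with the rounding it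
    costs the \<open>+ 2\<close> in the bound.\<close>
  define k where "k = Suc (nat \<lceil>2 * pi * s / h\<rceil>)"
  have "0 \<le> 2 * pi * s / h" using assms by simp
  then have k: "2 * pi * s / h \<le> real k" "real k \<le> 2 * pi * s / h + 2" "0 < k"
    unfolding k_def by linarith+
  define \<phi> where "\<phi> i = 2 * pi * real i / real k" for i :: nat
  \<comment> \<open>The first \<open>+ 1\<close> in the threshold accounts for the width of the strip, the second for turning the
    grid direction \<open>\<phi> i\<close> into the free one, which moves points of the segment by at most \<open>h\<close>.\<close>
  define W where "W i = {\<omega> \<in> space M. \<forall>n. \<forall>j<m. X n \<omega> \<in> strip (\<phi> i) 0 s h j \<longrightarrow> \<rho> n \<omega> < real (j + 2) * h}" for i
  define U where "U = (\<Union>i<k. W i)"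
  have h: "0 \<le> h" using assms by simp
  note [measurable] = strip_borel points_measurable radius_measurable
  have W_events: "W i \<in> events" for i
    unfolding W_def by measurable
  have "prob (W i) \<le> exp (- 2 * s * (integral\<^sup>L N R - 2 * h))" for i
  proof -
    have "2 * s * (integral\<^sup>L N R - 2 * h) \<le> 2 * s * (\<Sum>j<m. h * measure N {v \<in> space N. real (j + 2) * h \<le> R v})"
      using assms m by (intro mult_left_mono threshold_sum_lower) auto
    also have "\<dots> = (\<Sum>j<m. measure lborel (strip (\<phi> i) 0 s h j) * measure N {v \<in> space N. real (j + 2) * h \<le> R v})"
      by (simp only: strip_measure(2)[OF assms(1) h] sum_distrib_left mult.assoc diff_0_right)
    finally show ?thesis
      unfolding W_def
      by (subst void_prob) (auto simp: disjoint_strips[OF h] strip_borel strip_measure[OF assms(1) h, simplified])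
  qed
  then have "(\<Sum>i<k. prob (W i)) \<le> real k * exp (- 2 * s * (integral\<^sup>L N R - 2 * h))"
    using sum_bounded_above[of "{..<k}" "\<lambda>i. prob (W i)"] by simp
  also have "\<dots> \<le> (2 * pi * s / h + 2) * exp (- 2 * s * (integral\<^sup>L N R - 2 * h))"
    using k by (intro mult_right_mono) auto
  finally have "prob U \<le> (2 * pi * s / h + 2) * exp (- 2 * s * (integral\<^sup>L N R - 2 * h))"
    unfolding U_def using W_events
    by (intro order_trans[OF finite_measure_subadditive_finite]) auto
  moreover have "U \<in> events"
    unfolding U_def using W_events by auto
  moreover have "\<omega> \<in> U" if \<omega>: "\<omega> \<in> space M" and \<theta>: "0 \<le> \<theta>" "\<theta> < 2 * pi"
    and free: "\<And>t. 0 < t \<Longrightarrow> t \<le> s \<Longrightarrow> t *\<^sub>R dir \<theta> \<notin> occupied X \<rho> \<omega>" for \<omega> \<theta>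
  proof -
    define y where "y = real k * \<theta> / (2 * pi)"
    \<comment> \<open>This selects the last grid angle not exceeding \<open>\<theta>\<close>; since
      \<open>\<theta> < 2 * pi\<close>, no wrap-around occurs and \<open>i < k\<close>.\<close>
    define i where "i = nat \<lfloor>y\<rfloor>"
    have y: "0 \<le> y" "y < real k"
      using \<theta> k(3) by (auto simp: y_def field_simps)
    then have i: "real i \<le> y" "y \<le> real i + 1" "i < k"
      unfolding i_def by linarith+
    have "\<theta> - \<phi> i = 2 * pi / real k * (y - real i)"
      using k(3) by (simp add: y_def \<phi>_def field_simps)
    then have "\<bar>\<theta> - \<phi> i\<bar> \<le> 2 * pi / real k * 1"
      using i k(3) by (simp only: abs_mult) (intro mult_mono, auto)
    then have "s * \<bar>\<theta> - \<phi> i\<bar> \<le> s * (2 * pi / real k)"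
      using assms by (intro mult_left_mono) auto
    also have "\<dots> \<le> h"
      using k(1,3) assms by (simp add: field_simps)
    finally have close: "s * \<bar>\<theta> - \<phi> i\<bar> \<le> h" .
    have "\<omega> \<in> W i"
      unfolding W_def
    proof (safe intro!: \<omega>, rule ccontr)
      fix n j assume j: "j < m" and x: "X n \<omega> \<in> strip (\<phi> i) 0 s h j" and "\<not> \<rho> n \<omega> < real (j + 2) * h"
      \<comment> \<open>The foot of the perpendicular from the germ to the grid line has parameter
        \<open>t\<close>. The point with the same parameter on the free ray would be covered by the
        disc of this germ, a contradiction.\<close>
      define t where "t = X n \<omega> \<bullet> dir (\<phi> i)"
      have t: "0 < t" "t < s" using x by (auto simp: mem_strip[OF h] t_def)
      have "norm (X n \<omega> - t *\<^sub>R dir \<theta>) \<le> norm (X n \<omega> - t *\<^sub>R dir (\<phi> i)) + norm (t *\<^sub>R (dir (\<phi> i) - dir \<theta>))"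
        by (rule order_trans[OF _ norm_triangle_ineq]) (simp add: algebra_simps)
      also have "norm (X n \<omega> - t *\<^sub>R dir (\<phi> i)) \<le> real (Suc j) * h"
        using x by (simp add: t_def dist_foot mem_strip[OF h])
      also have "norm (t *\<^sub>R (dir (\<phi> i) - dir \<theta>)) \<le> s * \<bar>\<theta> - \<phi> i\<bar>"
        using t norm_dir_diff_le[of "\<phi> i" \<theta>] by (simp add: mult_mono abs_minus_commute)
      also note close
      also have "real (Suc j) * h + h \<le> \<rho> n \<omega>"
        using \<open>\<not> \<rho> n \<omega> < real (j + 2) * h\<close> by (simp add: algebra_simps)
      finally have "t *\<^sub>R dir \<theta> \<in> cball (X n \<omega>) (\<rho> n \<omega>)"
        by (simp add: dist_norm)
      then show False
        using free[of t] t by (auto simp: occupied_def)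
    qed
    then show ?thesis using i(3) by (auto simp: U_def)
  qed
  ultimately show ?thesis using that[of U] by blast
qed

section \<open>The conditioned event and the limit\<close>

definition visible_event :: "real \<Rightarrow> 'w set" where
  "visible_event r = {\<omega> \<in> space M. ereal r \<le> total_visibility (occupied X \<rho> \<omega>) \<and> 0 \<notin> occupied X \<rho> \<omega>}"

lemma origin_free_eq: "{\<omega> \<in> space M. 0 \<notin> occupied X \<rho> \<omega>} = free_segment 0 0"
  by (simp add: free_segment_def)

lemma visible_event_sets: "visible_event r \<in> sets (completion M)"
proof -
  \<comment> \<open>Almost surely the occupied set is locally closed, so the free directions form an open set and
    it suffices to look at rational angles.\<close>
  define B where "B \<omega> \<longleftrightarrow> \<omega> \<in> free_segment 0 0 \<and>
    (\<forall>k::nat. \<exists>q::rat. \<omega> \<in> free_segment (r - 1 / real (Suc k)) (of_rat q))" for \<omega>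
  define V where "V \<omega> \<longleftrightarrow> ereal r \<le> total_visibility (occupied X \<rho> \<omega>) \<and> 0 \<notin> occupied X \<rho> \<omega>" for \<omega>
  define D where "D \<omega> \<longleftrightarrow> V \<omega> \<noteq> B \<omega>" for \<omega>
  have "AE \<omega> in M. \<not> D \<omega>"
    using AE_occupied_locally_closed AE_space
  proof eventually_elim
    case (elim \<omega>)
    have "(\<exists>\<theta>. \<forall>t\<in>{0..s}. t *\<^sub>R dir \<theta> \<notin> occupied X \<rho> \<omega>)
        \<longleftrightarrow> (\<exists>q::rat. \<omega> \<in> free_segment s (of_rat q))" for s
    proof
      assume "\<exists>\<theta>. \<forall>t\<in>{0..s}. t *\<^sub>R dir \<theta> \<notin> occupied X \<rho> \<omega>"
      then obtain \<theta> where "\<forall>t\<in>{0..s}. t *\<^sub>R dir \<theta> \<notin> occupied X \<rho> \<omega>" by blast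
      from rational_free_direction[OF elim(1)[rule_format] this] obtain q :: rat
        where "\<forall>t\<in>{0..s}. t *\<^sub>R dir (of_rat q) \<notin> occupied X \<rho> \<omega>" .
      then show "\<exists>q::rat. \<omega> \<in> free_segment s (of_rat q)"
        using elim(2) by (auto simp: free_segment_def)
    qed (auto simp: free_segment_def)
    then show ?case
      unfolding D_def V_def B_def origin_free_eq[symmetric]
      using total_visibility_ge_iff[of "occupied X \<rho> \<omega>" r] elim(2) by auto
  qed
  then have [measurable]: "Measurable.pred (completion M) D"
    by (rule sets_completion_AE)
  have "Measurable.pred M B"
    unfolding B_def by measurable
  then have [measurable]: "Measurable.pred (completion M) B"
    by (rule measurable_completion)
  \<comment> \<open>\<open>V\<close> is the exclusive or of the measurable \<open>B\<close> and the
    almost surely false \<open>D\<close>, hence measurable for the completion.\<close>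
  have "Measurable.pred (completion M) (\<lambda>\<omega>. (B \<omega> \<and> \<not> D \<omega>) \<or> (\<not> B \<omega> \<and> D \<omega>))"
    by measurable
  moreover have "(\<lambda>\<omega>. (B \<omega> \<and> \<not> D \<omega>) \<or> (\<not> B \<omega> \<and> D \<omega>)) = V"
    by (auto simp: D_def)
  ultimately have "Measurable.pred (completion M) V" by simp
  then show ?thesis
    unfolding visible_event_def by (simp add: pred_def V_def)
qed

lemma visibility_tail_eq:
  "visibility_tail M X \<rho> r = measure (completion M) (visible_event r) / prob (free_segment 0 0)"
  by (simp add: visibility_tail_def cond_prob_def visible_event_def origin_free_eq)

lemma measure_completion_mono:
  assumes "A \<subseteq> B" "B \<in> sets (completion M)"
  shows "measure (completion M) A \<le> measure (completion M) B"
proof -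
  interpret C: finite_measure "completion M"
    by (rule finite_measureI) (simp add: emeasure_space_1)
  show ?thesis by (rule C.finite_measure_mono[OF assms])
qed

lemma visible_event_ge:
  assumes "0 \<le> r" "0 < h"
  shows "exp (- 2 * (r + 2 * K + 2) * (integral\<^sup>L N R + h)) \<le> measure (completion M) (visible_event r)"
proof -
  have "free_segment r 0 \<subseteq> visible_event r"
  proof
    fix \<omega> assume \<omega>: "\<omega> \<in> free_segment r 0"
    then have "ereal r \<le> total_visibility (occupied X \<rho> \<omega>)"
      by (intro total_visibility_geI[of _ 0]) (auto simp: free_segment_def)
    moreover have "0 \<notin> occupied X \<rho> \<omega>"
      using \<omega> assms unfolding free_segment_def by (auto dest: bspec[of _ _ 0])
    ultimately show "\<omega> \<in> visible_event r"
      using \<omega> by (auto simp: visible_event_def free_segment_def)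
  qed
  from measure_completion_mono[OF this visible_event_sets] show ?thesis
    using prob_free_segment_ge[OF assms] free_segment_events[of r 0] by simp
qed

text \<open>The loss of \<open>1\<close> in length pays for passing from the supremum to an actual
  direction; it disappears after division by \<open>r\<close>.\<close>

lemma visible_event_le:
  assumes "1 \<le> r" "0 < h"
  shows "measure (completion M) (visible_event r)
    \<le> (2 * pi * (r - 1) / h + 2) * exp (- 2 * (r - 1) * (integral\<^sup>L N R - 2 * h))"
proof -
  have "0 \<le> r - 1" using assms by simp
  then obtain U where U: "U \<in> events"
    "prob U \<le> (2 * pi * (r - 1) / h + 2) * exp (- 2 * (r - 1) * (integral\<^sup>L N R - 2 * h))"
    "\<And>\<omega> \<theta>. \<omega> \<in> space M \<Longrightarrow> 0 \<le> \<theta> \<Longrightarrow> \<theta> < 2 * pi \<Longrightarrow>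
      (\<And>t. 0 < t \<Longrightarrow> t \<le> r - 1 \<Longrightarrow> t *\<^sub>R dir \<theta> \<notin> occupied X \<rho> \<omega>) \<Longrightarrow> \<omega> \<in> U"
    using free_direction_cover[OF _ assms(2), of "r - 1"] by metis
  have "visible_event r \<subseteq> U"
  proof
    fix \<omega> assume \<omega>: "\<omega> \<in> visible_event r"
    then obtain \<theta> where "0 \<le> \<theta>" "\<theta> < 2 * pi" "\<And>t. 0 < t \<Longrightarrow> t \<le> r - 1 \<Longrightarrow> t *\<^sub>R dir \<theta> \<notin> occupied X \<rho> \<omega>"
      using total_visibility_free_direction[of r "occupied X \<rho> \<omega>" "r - 1"] by (auto simp: visible_event_def)
    then show "\<omega> \<in> U"
      using U(3) \<omega> by (auto simp: visible_event_def)
  qed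
  from measure_completion_mono[OF this] show ?thesis
    using U(1,2) by simp
qed

text \<open>The conditioning contributes the constant \<open>c\<close> and the union bound the
  logarithm of a linear function; both vanish after division by \<open>r\<close>. For fixed
  \<open>h\<close> the two bounds tend to \<open>- 2 * (E + h)\<close> and
  \<open>- 2 * (E - 2 * h)\<close>.\<close>

lemma visibility_tail_limit:
  "((\<lambda>r. 1 / r * ln (visibility_tail M X \<rho> r)) \<longlongrightarrow> - 2 * integral\<^sup>L N R) at_top"
proof -
  define E where "E = integral\<^sup>L N R"
  define v where "v r = measure (completion M) (visible_event r)" for r
  define c where "c = ln (prob (free_segment 0 0))"
  have p: "0 < prob (free_segment 0 0)"
    using prob_free_segment_ge[of 0 1] by (auto intro: less_le_trans[OF exp_gt_zero])
  have v_pos: "0 < v r" if "0 \<le> r" for r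
    using visible_event_ge[OF that, of 1] unfolding v_def by (auto intro: less_le_trans[OF exp_gt_zero])
  have ln_tail: "ln (visibility_tail M X \<rho> r) = ln (v r) - c" if "0 \<le> r" for r
    using v_pos[OF that] p by (simp add: visibility_tail_eq v_def c_def ln_div)
  have lower: "\<forall>\<^sub>F r in at_top. 1 / r * (- 2 * (r + 2 * K + 2) * (E + h) - c) \<le> 1 / r * ln (visibility_tail M X \<rho> r)"
    if h: "0 < h" for h
    using eventually_ge_at_top[of 1]
  proof eventually_elim
    case (elim r)
    then have "- 2 * (r + 2 * K + 2) * (E + h) \<le> ln (v r)"
      using visible_event_ge[of r h] h v_pos[of r] by (simp add: E_def v_def ln_ge_iff)
    then show ?case
      using elim by (intro mult_left_mono) (auto simp: ln_tail)
  qed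
  have upper: "\<forall>\<^sub>F r in at_top. 1 / r * ln (visibility_tail M X \<rho> r)
      \<le> 1 / r * (ln (2 * pi / h * (r - 1) + 2) - 2 * (r - 1) * (E - 2 * h) - c)"
    if h: "0 < h" for h
    using eventually_ge_at_top[of 1]
  proof eventually_elim
    case (elim r)
    have pos: "0 < 2 * pi / h * (r - 1) + 2"
      using elim h by (intro add_nonneg_pos) auto
    have "v r \<le> (2 * pi / h * (r - 1) + 2) * exp (- 2 * (r - 1) * (E - 2 * h))"
      using visible_event_le[OF elim h] by (simp add: E_def v_def)
    then have "ln (v r) \<le> ln ((2 * pi / h * (r - 1) + 2) * exp (- 2 * (r - 1) * (E - 2 * h)))"
      using v_pos[of r] elim by (subst ln_le_cancel_iff) (auto intro!: mult_pos_pos pos)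
    also have "\<dots> = ln (2 * pi / h * (r - 1) + 2) - 2 * (r - 1) * (E - 2 * h)"
      by (subst ln_mult_pos[OF pos exp_gt_zero]) (simp only: ln_exp minus_mult_left diff_conv_add_uminus)
    finally show ?case
      using elim by (intro mult_left_mono) (auto simp: ln_tail)
  qed
  have lim_lower: "((\<lambda>r. 1 / r * (- 2 * (r + 2 * K + 2) * (E + h) - c)) \<longlongrightarrow> - 2 * (E + h)) at_top" for h
    by real_asymp
  \<comment> \<open>Here \<open>d\<close> stands for \<open>2 * pi / h\<close>; only its sign
    matters for the asymptotics.\<close>
  have lim_upper: "((\<lambda>r. 1 / r * (ln (d * (r - 1) + 2) - 2 * (r - 1) * (E - 2 * h) - c)) \<longlongrightarrow> - 2 * (E - 2 * h)) at_top"
    if "0 < d" for d h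
    using that by real_asymp
  show ?thesis
    unfolding E_def[symmetric]
  proof (rule order_tendstoI)
    fix a assume a: "a < - 2 * E"
    \<comment> \<open>With this choice \<open>- 2 * (E + h)\<close> is the midpoint of
      \<open>a\<close> and \<open>- 2 * E\<close>.\<close>
    define h where "h = (- 2 * E - a) / 4"
    have h: "0 < h" "a < - 2 * (E + h)" using a by (auto simp: h_def field_simps)
    from order_tendstoD(1)[OF lim_lower h(2)] lower[OF h(1)]
    show "\<forall>\<^sub>F r in at_top. a < 1 / r * ln (visibility_tail M X \<rho> r)"
      by eventually_elim simp
  next
    fix a assume a: "- 2 * E < a"
    \<comment> \<open>With this choice \<open>- 2 * (E - 2 * h)\<close> is the midpoint of
      \<open>- 2 * E\<close> and \<open>a\<close>.\<close>
    define h where "h = (a + 2 * E) / 8"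
    have h: "0 < h" "- 2 * (E - 2 * h) < a" using a by (auto simp: h_def field_simps)
    have "0 < 2 * pi / h" using h by simp
    from order_tendstoD(2)[OF lim_upper[OF this] h(2)] upper[OF h(1)]
    show "\<forall>\<^sub>F r in at_top. 1 / r * ln (visibility_tail M X \<rho> r) < a"
      by eventually_elim simp
  qed
qed

end

theorem theorem3p1:
  fixes M :: "'w measure" and X :: "nat \<Rightarrow> 'w \<Rightarrow> real^2" and \<rho> :: "nat \<Rightarrow> 'w \<Rightarrow> real"
    and N :: "'v measure" and R :: "'v \<Rightarrow> real"
  assumes "disc_boolean_model M X \<rho> N R"
    and "AE v in N. 0 < R v"
    and "\<exists>K. AE v in N. R v \<le> K"
  shows "((\<lambda>r. 1 / r * ln (visibility_tail M X \<rho> r)) \<longlongrightarrow> - 2 * integral\<^sup>L N R) at_top"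
proof -
  obtain K where "AE v in N. R v \<le> K" using assms(3) by blast
  \<comment> \<open>The maximum with \<open>1\<close> supplies a bound that is visibly positive, as
    \<open>K_pos\<close> demands.\<close>
  then have "AE v in N. R v \<le> max K 1"
    by eventually_elim simp
  then interpret bounded_disc_model M X \<rho> N R "max K 1"
    using assms by (simp add: bounded_disc_model_def bounded_disc_model_axioms_def)
  show ?thesis by (rule visibility_tail_limit)
qed

end
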